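(* Let $F$ be an endofunctor on a category $\mathbb{B}$, $(F,m)$ a non-unital monad and $(F,\delta)$ a non-counital comonad such that $(F,m,\delta)$ satisfies the Frobenius property. Let $\eta:I_{\mathbb{B}}\to F$ be such that $(F,m,\eta)$ is a weak monad, put $\vartheta:=m\cdot F\eta:F\to F$, and assume $\delta=\delta\cdot\vartheta$. Then: (1) For any $\vartheta$-compatible $F$-module $(B,\varrho)$ there is a unique $\vartheta$-compatible $F$-module morphism $\omega:B\to F(B)$ making $(B,\varrho,\omega)$ a Frobenius bimodule, namely $$\omega:\ B\xrightarrow{\eta_B}F(B)\xrightarrow{\delta_B}FF(B)\xrightarrow{F(\varrho)}F(B).$$ (2) Any $F$-module morphism between $\vartheta$-compatible modules $(B,\varrho)$ and $(B',\varrho')$ becomes a morphism between the Frobenius bimodules $(B,\varrho,\omega)$ and $(B',\varrho',\omega')$, where $\omega,\omega'$ are obtained as in (1). (3) Let $\underline{\mathbb{B}}_F$ be the category of $\vartheta$-compatible $F$-modules, and let $\underline{\mathbb{B}}^F_F$ be the category of Frobenius bimodules which are $\vartheta$-compatible as $F$-modules. There is an isomorphism of categories $$\Phi:\underline{\mathbb{B}}_F\to\underline{\mathbb{B}}^F_F,\quad (B,\varrho)\mapsto(B,\varrho,\omega)$$ (with $\omega$ as in (1)), with the forgetful functor $U^F:\underline{\mathbb{B}}^F_F\to\underline{\mathbb{B}}_F$, $(B,\varrho,\omega)\mapsto(B,\varrho)$, as inverse.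
   Context: A non-unital monad $(F,m)$ has an associative natural transformation $m:FF\to F$; its (non-unital) modules are pairs $(B,\varrho)$ with $\varrho:F(B)\to B$ and $\varrho\cdot F(\varrho)=\varrho\cdot m_B$. A non-counital comonad $(F,\delta)$ has a coassociative natural transformation $\delta:F\to FF$; its (non-counital) comodules are pairs $(B,\omega)$ with $\omega:B\to F(B)$ and $F(\omega)\cdot\omega=\delta_B\cdot\omega$. Each $F(B)$ is regarded as a module via $m_B$. Morphisms of (co)modules are morphisms in $\mathbb{B}$ commuting with the structure maps. $(F,m,\eta)$ is a weak monad if $\eta=m\cdot F\eta\cdot\eta$, $m=m\cdot mF\cdot F\eta F$ and $m\cdot F\eta=m\cdot\eta F$. A module $(B,\varrho)$ is ($\vartheta$-)compatible if $\varrho\cdot\vartheta_B=\varrho$. A module morphism $h:(B,\varrho)\to(B',\varrho')$ is $\vartheta$-compatible if $h\cdot\varrho\cdot\eta_B=h$ (equivalently $\varrho'\cdot\eta_{B'}\cdot h=h$); for $h$ with codomain $(F(B),m_B)$ this means $\vartheta_B\cdot h=h$. $(F,m,\delta)$ satisfies the Frobenius property if $Fm\cdot\delta F=\delta\cdot m=mF\cdot F\delta$. A Frobenius bimodule is a triple $(B,\varrho,\omega)$ with $(B,\varrho)$ a non-unital module, $(B,\omega)$ a non-counital comodule and $F(\varrho)\cdot\delta_B=\omega\cdot\varrho=m_B\cdot F(\omega)$. It is $\vartheta$-compatible as an $F$-module if $(B,\varrho)$ is a $\vartheta$-compatible module. Morphisms of Frobenius bimodules are morphisms in $\mathbb{B}$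 which are both module and comodule morphisms.
   Formalization: In (3) the isomorphism is onto the full subcategory of Frobenius bimodules whose ω is itself a ϑ-compatible module morphism; for all bimodules it fails (F=Id, m=δ=η=0, any nonzero ω with ω²=0), though Φ and U^F are functors there with U^F Φ = id. *)

theory Defs
  imports Main
begin

section \<open>Categories, functors, natural transformations\<close>

record ('o, 'a) cat =
  Obj :: "'o set"
  Arr :: "'a set"
  Dom :: "'a \<Rightarrow> 'o"
  Cod :: "'a \<Rightarrow> 'o"
  Ident :: "'o \<Rightarrow> 'a"
  Comp :: "'a \<Rightarrow> 'a \<Rightarrow> 'a"  (infixr "\<cdot>\<index>" 70)

definition hom :: "('o, 'a) cat \<Rightarrow> 'o \<Rightarrow> 'o \<Rightarrow> 'a set" where
  "hom C X Y = {f \<in> Arr C. Dom C f = X \<and> Cod C f = Y}"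

definition category :: "('o, 'a) cat \<Rightarrow> bool" where
  "category C \<longleftrightarrow>
     (\<forall>f\<in>Arr C. Dom C f \<in> Obj C \<and> Cod C f \<in> Obj C) \<and>
     (\<forall>X\<in>Obj C. Ident C X \<in> hom C X X) \<and>
     (\<forall>f\<in>Arr C. \<forall>g\<in>Arr C. Cod C f = Dom C g \<longrightarrow> g \<cdot>\<^bsub>C\<^esub> f \<in> hom C (Dom C f) (Cod C g)) \<and>
     (\<forall>f\<in>Arr C. f \<cdot>\<^bsub>C\<^esub> Ident C (Dom C f) = f \<and> Ident C (Cod C f) \<cdot>\<^bsub>C\<^esub> f = f) \<and>
     (\<forall>f\<in>Arr C. \<forall>g\<in>Arr C. \<forall>h\<in>Arr C. Cod C f = Dom C g \<and> Cod C g = Dom C h \<longrightarrow>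
        (h \<cdot>\<^bsub>C\<^esub> g) \<cdot>\<^bsub>C\<^esub> f = h \<cdot>\<^bsub>C\<^esub> (g \<cdot>\<^bsub>C\<^esub> f))"

definition full_subcat :: "('o, 'a) cat \<Rightarrow> 'o set \<Rightarrow> ('o, 'a) cat" where
  "full_subcat C S = C\<lparr>Obj := Obj C \<inter> S, Arr := {f \<in> Arr C. Dom C f \<in> S \<and> Cod C f \<in> S}\<rparr>"

record ('o, 'a, 'p, 'b) ftor =
  on_obj :: "'o \<Rightarrow> 'p"  ("_\<bullet>" [1000] 1000)
  on_arr :: "'a \<Rightarrow> 'b"  ("_\<star>" [1000] 1000)

definition is_functor :: "('o, 'a) cat \<Rightarrow> ('p, 'b) cat \<Rightarrow> ('o, 'a, 'p, 'b) ftor \<Rightarrow> bool" where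
  "is_functor C D F \<longleftrightarrow> category C \<and> category D \<and>
     (\<forall>X\<in>Obj C. F\<bullet> X \<in> Obj D) \<and>
     (\<forall>f\<in>Arr C. F\<star> f \<in> hom D (F\<bullet> (Dom C f)) (F\<bullet> (Cod C f))) \<and>
     (\<forall>X\<in>Obj C. F\<star> (Ident C X) = Ident D (F\<bullet> X)) \<and>
     (\<forall>f\<in>Arr C. \<forall>g\<in>Arr C. Cod C f = Dom C g \<longrightarrow> F\<star> (g \<cdot>\<^bsub>C\<^esub> f) = F\<star> g \<cdot>\<^bsub>D\<^esub> F\<star> f)"

definition id_ftor :: "('o, 'a, 'o, 'a) ftor" where
  "id_ftor = \<lparr>on_obj = (\<lambda>X. X), on_arr = (\<lambda>f. f)\<rparr>"

definition comp_ftor ::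
  "('p, 'b, 'q, 'c) ftor \<Rightarrow> ('o, 'a, 'p, 'b) ftor \<Rightarrow> ('o, 'a, 'q, 'c) ftor"  (infixr "\<odot>" 75) where
  "G \<odot> F = \<lparr>on_obj = (\<lambda>X. G\<bullet> (F\<bullet> X)), on_arr = (\<lambda>f. G\<star> (F\<star> f))\<rparr>"

text \<open>Functors are total HOL functions, so equality of functors out of \<open>C\<close> is agreement on the
  objects and arrows of \<open>C\<close>.\<close>

definition ftor_eq :: "('o, 'a) cat \<Rightarrow> ('o, 'a, 'p, 'b) ftor \<Rightarrow> ('o, 'a, 'p, 'b) ftor \<Rightarrow> bool" where
  "ftor_eq C F G \<longleftrightarrow> (\<forall>X\<in>Obj C. F\<bullet> X = G\<bullet> X) \<and> (\<forall>f\<in>Arr C. F\<star> f = G\<star> f)"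

definition iso_of_categories ::
  "('o, 'a) cat \<Rightarrow> ('p, 'b) cat \<Rightarrow> ('o, 'a, 'p, 'b) ftor \<Rightarrow> ('p, 'b, 'o, 'a) ftor \<Rightarrow> bool" where
  "iso_of_categories C D F G \<longleftrightarrow> is_functor C D F \<and> is_functor D C G \<and>
     ftor_eq C (G \<odot> F) id_ftor \<and> ftor_eq D (F \<odot> G) id_ftor"

definition nat_trans ::
  "('o, 'a) cat \<Rightarrow> ('p, 'b) cat \<Rightarrow> ('o, 'a, 'p, 'b) ftor \<Rightarrow> ('o, 'a, 'p, 'b) ftor \<Rightarrow> ('o \<Rightarrow> 'b) \<Rightarrow> bool"
  where
  "nat_trans C D F G \<tau> \<longleftrightarrow> is_functor C D F \<and> is_functor C D G \<and>
     (\<forall>X\<in>Obj C. \<tau> X \<in> hom D (F\<bullet> X) (G\<bullet> X)) \<and>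
     (\<forall>f\<in>Arr C. G\<star> f \<cdot>\<^bsub>D\<^esub> \<tau> (Dom C f) = \<tau> (Cod C f) \<cdot>\<^bsub>D\<^esub> F\<star> f)"

section \<open>Non-unital monads, non-counital comonads and weak monads\<close>

type_synonym ('o, 'a) endo = "('o, 'a, 'o, 'a) ftor"

definition nonunital_monad :: "('o, 'a) cat \<Rightarrow> ('o, 'a) endo \<Rightarrow> ('o \<Rightarrow> 'a) \<Rightarrow> bool" where
  "nonunital_monad B F m \<longleftrightarrow> nat_trans B B (F \<odot> F) F m \<and>
     (\<forall>X\<in>Obj B. m X \<cdot>\<^bsub>B\<^esub> F\<star> (m X) = m X \<cdot>\<^bsub>B\<^esub> m (F\<bullet> X))"

definition noncounital_comonad :: "('o, 'a) cat \<Rightarrow> ('o, 'a) endo \<Rightarrow> ('o \<Rightarrow> 'a) \<Rightarrow> bool" where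
  "noncounital_comonad B F \<delta> \<longleftrightarrow> nat_trans B B F (F \<odot> F) \<delta> \<and>
     (\<forall>X\<in>Obj B. F\<star> (\<delta> X) \<cdot>\<^bsub>B\<^esub> \<delta> X = \<delta> (F\<bullet> X) \<cdot>\<^bsub>B\<^esub> \<delta> X)"

text \<open>The components at \<open>X\<close> of the whiskered transformations \<open>F\<tau>\<close> and \<open>\<tau>F\<close> are \<open>F (\<tau> X)\<close> and
  \<open>\<tau> (F X)\<close>.\<close>

definition weak_monad ::
  "('o, 'a) cat \<Rightarrow> ('o, 'a) endo \<Rightarrow> ('o \<Rightarrow> 'a) \<Rightarrow> ('o \<Rightarrow> 'a) \<Rightarrow> bool" where
  "weak_monad B F m \<eta> \<longleftrightarrow> nonunital_monad B F m \<and> nat_trans B B id_ftor F \<eta> \<and>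
     (\<forall>X\<in>Obj B.
        \<eta> X = m X \<cdot>\<^bsub>B\<^esub> F\<star> (\<eta> X) \<cdot>\<^bsub>B\<^esub> \<eta> X \<and>
        m X = m X \<cdot>\<^bsub>B\<^esub> m (F\<bullet> X) \<cdot>\<^bsub>B\<^esub> F\<star> (\<eta> (F\<bullet> X)) \<and>
        m X \<cdot>\<^bsub>B\<^esub> F\<star> (\<eta> X) = m X \<cdot>\<^bsub>B\<^esub> \<eta> (F\<bullet> X))"

definition theta ::
  "('o, 'a) cat \<Rightarrow> ('o, 'a) endo \<Rightarrow> ('o \<Rightarrow> 'a) \<Rightarrow> ('o \<Rightarrow> 'a) \<Rightarrow> 'o \<Rightarrow> 'a" where
  "theta B F m \<eta> X = m X \<cdot>\<^bsub>B\<^esub> F\<star> (\<eta> X)"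

definition frobenius_property ::
  "('o, 'a) cat \<Rightarrow> ('o, 'a) endo \<Rightarrow> ('o \<Rightarrow> 'a) \<Rightarrow> ('o \<Rightarrow> 'a) \<Rightarrow> bool" where
  "frobenius_property B F m \<delta> \<longleftrightarrow> (\<forall>X\<in>Obj B.
     F\<star> (m X) \<cdot>\<^bsub>B\<^esub> \<delta> (F\<bullet> X) = \<delta> X \<cdot>\<^bsub>B\<^esub> m X \<and>
     \<delta> X \<cdot>\<^bsub>B\<^esub> m X = m (F\<bullet> X) \<cdot>\<^bsub>B\<^esub> F\<star> (\<delta> X))"

section \<open>Modules, comodules and Frobenius bimodules\<close>

definition is_module ::
  "('o, 'a) cat \<Rightarrow> ('o, 'a) endo \<Rightarrow> ('o \<Rightarrow> 'a) \<Rightarrow> 'o \<Rightarrow> 'a \<Rightarrow> bool" where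
  "is_module B F m X \<rho> \<longleftrightarrow> X \<in> Obj B \<and> \<rho> \<in> hom B (F\<bullet> X) X \<and>
     \<rho> \<cdot>\<^bsub>B\<^esub> F\<star> \<rho> = \<rho> \<cdot>\<^bsub>B\<^esub> m X"

definition is_comodule ::
  "('o, 'a) cat \<Rightarrow> ('o, 'a) endo \<Rightarrow> ('o \<Rightarrow> 'a) \<Rightarrow> 'o \<Rightarrow> 'a \<Rightarrow> bool" where
  "is_comodule B F \<delta> X \<omega> \<longleftrightarrow> X \<in> Obj B \<and> \<omega> \<in> hom B X (F\<bullet> X) \<and>
     F\<star> \<omega> \<cdot>\<^bsub>B\<^esub> \<omega> = \<delta> X \<cdot>\<^bsub>B\<^esub> \<omega>"

definition module_morphism ::
  "('o, 'a) cat \<Rightarrow> ('o, 'a) endo \<Rightarrow> 'o \<times> 'a \<Rightarrow> 'o \<times> 'a \<Rightarrow> 'a \<Rightarrow> bool" where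
  "module_morphism B F = (\<lambda>(X, \<rho>) (Y, \<sigma>) h. h \<in> hom B X Y \<and> h \<cdot>\<^bsub>B\<^esub> \<rho> = \<sigma> \<cdot>\<^bsub>B\<^esub> F\<star> h)"

definition comodule_morphism ::
  "('o, 'a) cat \<Rightarrow> ('o, 'a) endo \<Rightarrow> 'o \<times> 'a \<Rightarrow> 'o \<times> 'a \<Rightarrow> 'a \<Rightarrow> bool" where
  "comodule_morphism B F = (\<lambda>(X, \<omega>) (Y, \<upsilon>) h. h \<in> hom B X Y \<and> \<upsilon> \<cdot>\<^bsub>B\<^esub> h = F\<star> h \<cdot>\<^bsub>B\<^esub> \<omega>)"

definition compatible_module ::
  "('o, 'a) cat \<Rightarrow> ('o, 'a) endo \<Rightarrow> ('o \<Rightarrow> 'a) \<Rightarrow> ('o \<Rightarrow> 'a) \<Rightarrow> 'o \<Rightarrow> 'a \<Rightarrow> bool" where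
  "compatible_module B F m \<eta> X \<rho> \<longleftrightarrow> is_module B F m X \<rho> \<and> \<rho> \<cdot>\<^bsub>B\<^esub> theta B F m \<eta> X = \<rho>"

definition compatible_morphism ::
  "('o, 'a) cat \<Rightarrow> ('o, 'a) endo \<Rightarrow> ('o \<Rightarrow> 'a) \<Rightarrow> 'o \<times> 'a \<Rightarrow> 'o \<times> 'a \<Rightarrow> 'a \<Rightarrow> bool" where
  "compatible_morphism B F \<eta> = (\<lambda>(X, \<rho>) (Y, \<sigma>) h.
     module_morphism B F (X, \<rho>) (Y, \<sigma>) h \<and> h \<cdot>\<^bsub>B\<^esub> \<rho> \<cdot>\<^bsub>B\<^esub> \<eta> X = h)"

definition frobenius_bimodule ::
  "('o, 'a) cat \<Rightarrow> ('o, 'a) endo \<Rightarrow> ('o \<Rightarrow> 'a) \<Rightarrow> ('o \<Rightarrow> 'a) \<Rightarrow> 'o \<Rightarrow> 'a \<Rightarrow> 'a \<Rightarrow> bool" where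
  "frobenius_bimodule B F m \<delta> X \<rho> \<omega> \<longleftrightarrow> is_module B F m X \<rho> \<and> is_comodule B F \<delta> X \<omega> \<and>
     F\<star> \<rho> \<cdot>\<^bsub>B\<^esub> \<delta> X = \<omega> \<cdot>\<^bsub>B\<^esub> \<rho> \<and> \<omega> \<cdot>\<^bsub>B\<^esub> \<rho> = m X \<cdot>\<^bsub>B\<^esub> F\<star> \<omega>"

definition frobenius_morphism ::
  "('o, 'a) cat \<Rightarrow> ('o, 'a) endo \<Rightarrow> 'o \<times> 'a \<times> 'a \<Rightarrow> 'o \<times> 'a \<times> 'a \<Rightarrow> 'a \<Rightarrow> bool" where
  "frobenius_morphism B F = (\<lambda>(X, \<rho>, \<omega>) (Y, \<sigma>, \<upsilon>) h.
     module_morphism B F (X, \<rho>) (Y, \<sigma>) h \<and> comodule_morphism B F (X, \<omega>) (Y, \<upsilon>) h)"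

definition coaction ::
  "('o, 'a) cat \<Rightarrow> ('o, 'a) endo \<Rightarrow> ('o \<Rightarrow> 'a) \<Rightarrow> ('o \<Rightarrow> 'a) \<Rightarrow> 'o \<Rightarrow> 'a \<Rightarrow> 'a" where
  "coaction B F \<delta> \<eta> X \<rho> = F\<star> \<rho> \<cdot>\<^bsub>B\<^esub> \<delta> X \<cdot>\<^bsub>B\<^esub> \<eta> X"

section \<open>The categories of modules and Frobenius bimodules\<close>

text \<open>Category of structured objects of \<open>B\<close>: an arrow is a triple (source, underlying arrow of
  \<open>B\<close>, target), since an arrow of \<open>B\<close> does not determine the structures on its ends.\<close>

definition structured_cat ::
  "('o, 'a) cat \<Rightarrow> 's set \<Rightarrow> ('s \<Rightarrow> 'o) \<Rightarrow> ('s \<Rightarrow> 's \<Rightarrow> 'a \<Rightarrow> bool) \<Rightarrow> ('s, 's \<times> 'a \<times> 's) cat" where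
  "structured_cat B S u P = \<lparr>
     Obj = S,
     Arr = {(x, h, y). x \<in> S \<and> y \<in> S \<and> P x y h},
     Dom = (\<lambda>(x, h, y). x),
     Cod = (\<lambda>(x, h, y). y),
     Ident = (\<lambda>x. (x, Ident B (u x), x)),
     Comp = (\<lambda>(y', k, z) (x, h, y). (x, k \<cdot>\<^bsub>B\<^esub> h, z))\<rparr>"

text \<open>The morphisms of both categories are all (bi)module morphisms; compatibility is imposed on
  objects only (an identity is a compatible morphism only if \<open>\<rho> \<cdot> \<eta>\<close> is the identity).\<close>

definition compatible_modules ::
  "('o, 'a) cat \<Rightarrow> ('o, 'a) endo \<Rightarrow> ('o \<Rightarrow> 'a) \<Rightarrow> ('o \<Rightarrow> 'a) \<Rightarrow>
   ('o \<times> 'a, ('o \<times> 'a) \<times> 'a \<times> ('o \<times> 'a)) cat" where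
  "compatible_modules B F m \<eta> =
     structured_cat B {(X, \<rho>). compatible_module B F m \<eta> X \<rho>} (\<lambda>(X, \<rho>). X) (module_morphism B F)"

definition frobenius_bimodules ::
  "('o, 'a) cat \<Rightarrow> ('o, 'a) endo \<Rightarrow> ('o \<Rightarrow> 'a) \<Rightarrow> ('o \<Rightarrow> 'a) \<Rightarrow> ('o \<Rightarrow> 'a) \<Rightarrow>
   ('o \<times> 'a \<times> 'a, ('o \<times> 'a \<times> 'a) \<times> 'a \<times> ('o \<times> 'a \<times> 'a)) cat" where
  "frobenius_bimodules B F m \<delta> \<eta> =
     structured_cat B
       {(X, \<rho>, \<omega>). frobenius_bimodule B F m \<delta> X \<rho> \<omega> \<and> compatible_module B F m \<eta> X \<rho>}
       (\<lambda>(X, \<rho>, \<omega>). X) (frobenius_morphism B F)"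

text \<open>Compatibility of \<open>(B, \<rho>)\<close> does not imply compatibility of \<open>\<omega>\<close>: for the identity functor with
  \<open>m\<close>, \<open>\<delta>\<close>, \<open>\<eta>\<close> all zero, \<open>(B, 0, \<omega>)\<close> is a Frobenius bimodule whenever \<open>\<omega> \<cdot> \<omega> = 0\<close>. The forgetful
  functor is therefore not injective on the objects of \<open>frobenius_bimodules\<close>; it can be inverted
  on the following full subcategory.\<close>

definition compatible_frobenius_bimodules ::
  "('o, 'a) cat \<Rightarrow> ('o, 'a) endo \<Rightarrow> ('o \<Rightarrow> 'a) \<Rightarrow> ('o \<Rightarrow> 'a) \<Rightarrow> ('o \<Rightarrow> 'a) \<Rightarrow>
   ('o \<times> 'a \<times> 'a, ('o \<times> 'a \<times> 'a) \<times> 'a \<times> ('o \<times> 'a \<times> 'a)) cat" where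
  "compatible_frobenius_bimodules B F m \<delta> \<eta> =
     full_subcat (frobenius_bimodules B F m \<delta> \<eta>)
       {(X, \<rho>, \<omega>). compatible_morphism B F \<eta> (X, \<rho>) (F\<bullet> X, m X) \<omega>}"

definition Phi ::
  "('o, 'a) cat \<Rightarrow> ('o, 'a) endo \<Rightarrow> ('o \<Rightarrow> 'a) \<Rightarrow> ('o \<Rightarrow> 'a) \<Rightarrow>
   ('o \<times> 'a, ('o \<times> 'a) \<times> 'a \<times> ('o \<times> 'a),
    'o \<times> 'a \<times> 'a, ('o \<times> 'a \<times> 'a) \<times> 'a \<times> ('o \<times> 'a \<times> 'a)) ftor" where
  "Phi B F \<delta> \<eta> = \<lparr>
     on_obj = (\<lambda>(X, \<rho>). (X, \<rho>, coaction B F \<delta> \<eta> X \<rho>)),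
     on_arr = (\<lambda>((X, \<rho>), h, (Y, \<sigma>)).
       ((X, \<rho>, coaction B F \<delta> \<eta> X \<rho>), h, (Y, \<sigma>, coaction B F \<delta> \<eta> Y \<sigma>)))\<rparr>"

definition forget ::
  "('o \<times> 'a \<times> 'a, ('o \<times> 'a \<times> 'a) \<times> 'a \<times> ('o \<times> 'a \<times> 'a),
    'o \<times> 'a, ('o \<times> 'a) \<times> 'a \<times> ('o \<times> 'a)) ftor" where
  "forget = \<lparr>
     on_obj = (\<lambda>(X, \<rho>, \<omega>). (X, \<rho>)),
     on_arr = (\<lambda>((X, \<rho>, \<omega>), h, (Y, \<sigma>, \<upsilon>)). ((X, \<rho>), h, (Y, \<sigma>)))\<rparr>"

end

theory Submission
  imports Defs
begin

text \<open>Naturality, the module law \<open>\<rho> \<cdot> F \<rho> = \<rho> \<cdot> m\<close>, the Frobenius property and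
  \<open>\<delta> \<cdot> m \<cdot> \<eta> = \<delta> \<cdot> m \<cdot> F \<eta> = \<delta>\<close> reduce both \<open>\<omega> \<cdot> \<rho>\<close> and \<open>m \<cdot> F \<omega>\<close> to \<open>F \<rho> \<cdot> \<delta>\<close> when
  \<open>\<omega> = F \<rho> \<cdot> \<delta> \<cdot> \<eta>\<close>. Conversely, if \<open>\<omega>\<close> is compatible and \<open>\<omega> \<cdot> \<rho> = F \<rho> \<cdot> \<delta>\<close>, then
  \<open>\<omega> = \<omega> \<cdot> \<rho> \<cdot> \<eta> = F \<rho> \<cdot> \<delta> \<cdot> \<eta>\<close>.\<close>

section \<open>Calculating with composites in an abstract category\<close>

lemma homD:
  assumes "f \<in> hom C X Y"
  shows "f \<in> Arr C" "Dom C f = X" "Cod C f = Y"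
  using assms by (simp_all add: hom_def)

locale abstract_category =
  fixes C :: "('o, 'a) cat" (structure)
  assumes category: "category C"
begin

lemma obj_dom [simp]: "f \<in> Arr C \<Longrightarrow> Dom C f \<in> Obj C"
  and obj_cod [simp]: "f \<in> Arr C \<Longrightarrow> Cod C f \<in> Obj C"
  using category by (auto simp: category_def)

lemma ident [simp]:
  assumes "X \<in> Obj C"
  shows "Ident C X \<in> Arr C" "Dom C (Ident C X) = X" "Cod C (Ident C X) = X"
  using assms category by (auto simp: category_def hom_def)

lemma comp [simp]:
  assumes "f \<in> Arr C" "g \<in> Arr C" "Cod C f = Dom C g"
  shows "g \<cdot> f \<in> Arr C" "Dom C (g \<cdot> f) = Dom C f" "Cod C (g \<cdot> f) = Cod C g"
  using assms category by (auto simp: category_def hom_def)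

lemma comp_ident [simp]:
  "f \<in> Arr C \<Longrightarrow> Dom C f = X \<Longrightarrow> f \<cdot> Ident C X = f"
  "f \<in> Arr C \<Longrightarrow> Cod C f = Y \<Longrightarrow> Ident C Y \<cdot> f = f"
  using category by (auto simp: category_def)

lemma assoc [simp]:
  assumes "f \<in> Arr C" "g \<in> Arr C" "h \<in> Arr C" "Cod C f = Dom C g" "Cod C g = Dom C h"
  shows "(h \<cdot> g) \<cdot> f = h \<cdot> g \<cdot> f"
  using assms category by (auto simp: category_def)

text \<open>Since \<open>assoc\<close> brackets every composite to the right,
  \<open>h \<cdot> g\<close> is no subterm of \<open>h \<cdot> g \<cdot> f\<close>. This form lets
  an equation between two factors rewrite the head of a longer composite.\<close>

lemma comp_left:
  assumes "h \<cdot> g = k" "f \<in> Arr C" "g \<in> Arr C" "h \<in> Arr C" "Cod C f = Dom C g" "Cod C g = Dom C h"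
  shows "h \<cdot> g \<cdot> f = k \<cdot> f"
  using assms assoc by metis

lemma hom_comp: "f \<in> hom C X Y \<Longrightarrow> g \<in> hom C Y Z \<Longrightarrow> g \<cdot> f \<in> hom C X Z"
  by (simp add: hom_def)

text \<open>Associativity and the unit laws are inherited from the underlying arrows in
  \<open>C\<close>. What remains is that \<open>P\<close> implies the right typing and is closed
  under identities and composition.\<close>

lemma category_structured_cat:
  assumes u: "\<And>x. x \<in> S \<Longrightarrow> u x \<in> Obj C"
    and P: "\<And>x y h. x \<in> S \<Longrightarrow> y \<in> S \<Longrightarrow> P x y h \<Longrightarrow> h \<in> hom C (u x) (u y)"
    and P_ident: "\<And>x. x \<in> S \<Longrightarrow> P x x (Ident C (u x))"
    and P_comp: "\<And>x y z h k. x \<in> S \<Longrightarrow> y \<in> S \<Longrightarrow> z \<in> S \<Longrightarrow> P x y h \<Longrightarrow> P y z k \<Longrightarrow> P x z (k \<cdot> h)"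
  shows "category (structured_cat C S u P)"
proof -
  \<comment> \<open>\<open>P\<close> does not display domains and codomains, which
    \<open>comp\<close> and \<open>assoc\<close> need, so their instances are derived here under
    \<open>P\<close> itself.\<close>
  have "k \<cdot> h \<in> Arr C" "(l \<cdot> k) \<cdot> h = l \<cdot> k \<cdot> h"
    if "x \<in> S" "y \<in> S" "z \<in> S" "w \<in> S" "P x y h" "P y z k" "P z w l" for x y z w h k l
    using P[OF \<open>x \<in> S\<close> \<open>y \<in> S\<close>] P[OF \<open>y \<in> S\<close> \<open>z \<in> S\<close>] P[OF \<open>z \<in> S\<close> \<open>w \<in> S\<close>] that
    by (auto simp: hom_def)
  moreover have "h \<cdot> Ident C (u x) = h" "Ident C (u y) \<cdot> h = h"
    if "x \<in> S" "y \<in> S" "P x y h" for x y h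
    using P[OF that] by (auto simp: hom_def)
  ultimately show ?thesis
    using P_ident P_comp unfolding category_def structured_cat_def
    by (auto simp: hom_def)
qed

lemma category_full_subcat: "category (full_subcat C S)"
  unfolding category_def full_subcat_def by (auto simp: hom_def)

end

section \<open>Functors into and out of full subcategories\<close>

lemma is_functor_full_subcat_codomain:
  assumes "is_functor C D F" and "\<And>X. X \<in> Obj C \<Longrightarrow> F\<bullet> X \<in> S"
  shows "is_functor C (full_subcat D S) F"
proof -
  interpret C: abstract_category C
    by unfold_locales (use assms in \<open>simp add: is_functor_def\<close>)
  interpret D: abstract_category D
    by unfold_locales (use assms in \<open>simp add: is_functor_def\<close>)
  show ?thesis
    using assms D.category_full_subcat[of S]
    unfolding is_functor_def by (auto simp: full_subcat_def hom_def)
qed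

lemma is_functor_full_subcat_domain:
  assumes "is_functor C D F"
  shows "is_functor (full_subcat C S) D F"
proof -
  interpret C: abstract_category C
    by unfold_locales (use assms in \<open>simp add: is_functor_def\<close>)
  show ?thesis
    using assms C.category_full_subcat[of S]
    unfolding is_functor_def by (auto simp: full_subcat_def hom_def)
qed

section \<open>Typing and structural equations of the given data\<close>

locale weak_frobenius_monad = abstract_category B
  for B :: "('o, 'a) cat" (structure) +
  fixes F :: "('o, 'a) endo" and m \<delta> \<eta> :: "'o \<Rightarrow> 'a"
  assumes endofunctor: "is_functor B B F"
    and monad: "nonunital_monad B F m"
    and comonad: "noncounital_comonad B F \<delta>"
    and frobenius: "frobenius_property B F m \<delta>"
    and weak_unit: "weak_monad B F m \<eta>"
    and \<delta>_theta: "\<forall>X\<in>Obj B. \<delta> X = \<delta> X \<cdot> theta B F m \<eta> X"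
begin

text \<open>This and the typing rules up to \<open>\<eta>_arr\<close> discharge the side conditions
  of \<open>assoc\<close>, \<open>F_comp\<close> and \<open>comp_left\<close>, so that the later
  calculations can run on diagram equations alone.\<close>

lemma F_obj [simp]: "X \<in> Obj B \<Longrightarrow> F\<bullet> X \<in> Obj B"
  and F_ident [simp]: "X \<in> Obj B \<Longrightarrow> F\<star> (Ident B X) = Ident B (F\<bullet> X)"
  using endofunctor by (auto simp: is_functor_def)

lemma F_arr [simp]:
  assumes "f \<in> Arr B"
  shows "F\<star> f \<in> Arr B" "Dom B (F\<star> f) = F\<bullet> (Dom B f)" "Cod B (F\<star> f) = F\<bullet> (Cod B f)"
  using assms endofunctor by (auto simp: is_functor_def hom_def)

lemma F_comp [simp]:
  "f \<in> Arr B \<Longrightarrow> g \<in> Arr B \<Longrightarrow> Cod B f = Dom B g \<Longrightarrow> F\<star> (g \<cdot> f) = F\<star> g \<cdot> F\<star> f"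
  using endofunctor by (auto simp: is_functor_def)

lemma m_arr [simp]:
  assumes "X \<in> Obj B"
  shows "m X \<in> Arr B" "Dom B (m X) = F\<bullet> (F\<bullet> X)" "Cod B (m X) = F\<bullet> X"
  using assms monad by (auto simp: nonunital_monad_def nat_trans_def comp_ftor_def hom_def)

lemma \<delta>_arr [simp]:
  assumes "X \<in> Obj B"
  shows "\<delta> X \<in> Arr B" "Dom B (\<delta> X) = F\<bullet> X" "Cod B (\<delta> X) = F\<bullet> (F\<bullet> X)"
  using assms comonad by (auto simp: noncounital_comonad_def nat_trans_def comp_ftor_def hom_def)

lemma \<eta>_arr [simp]:
  assumes "X \<in> Obj B"
  shows "\<eta> X \<in> Arr B" "Dom B (\<eta> X) = X" "Cod B (\<eta> X) = F\<bullet> X"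
  using assms weak_unit by (auto simp: weak_monad_def nat_trans_def id_ftor_def hom_def)

lemma m_natural: "f \<in> hom B X Y \<Longrightarrow> m Y \<cdot> F\<star> (F\<star> f) = F\<star> f \<cdot> m X"
  using monad by (auto simp: nonunital_monad_def nat_trans_def comp_ftor_def hom_def)

lemma \<delta>_natural: "f \<in> hom B X Y \<Longrightarrow> \<delta> Y \<cdot> F\<star> f = F\<star> (F\<star> f) \<cdot> \<delta> X"
  using comonad by (auto simp: noncounital_comonad_def nat_trans_def comp_ftor_def hom_def)

lemma \<eta>_natural: "f \<in> hom B X Y \<Longrightarrow> \<eta> Y \<cdot> f = F\<star> f \<cdot> \<eta> X"
  using weak_unit by (auto simp: weak_monad_def nat_trans_def id_ftor_def hom_def)

lemma coassoc: "X \<in> Obj B \<Longrightarrow> F\<star> (\<delta> X) \<cdot> \<delta> X = \<delta> (F\<bullet> X) \<cdot> \<delta> X"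
  using comonad by (auto simp: noncounital_comonad_def)

lemma frobenius_left: "X \<in> Obj B \<Longrightarrow> F\<star> (m X) \<cdot> \<delta> (F\<bullet> X) = \<delta> X \<cdot> m X"
  and frobenius_right: "X \<in> Obj B \<Longrightarrow> m (F\<bullet> X) \<cdot> F\<star> (\<delta> X) = \<delta> X \<cdot> m X"
  using frobenius by (auto simp: frobenius_property_def)

lemma m_\<eta>: "X \<in> Obj B \<Longrightarrow> m X \<cdot> \<eta> (F\<bullet> X) = m X \<cdot> F\<star> (\<eta> X)"
  using weak_unit by (auto simp: weak_monad_def)

text \<open>The hypothesis \<open>\<delta> = \<delta> \<cdot> \<vartheta>\<close> in right-nested
  form. Together with \<open>m_\<eta>\<close> it makes \<open>\<delta>\<close> absorb
  \<open>m\<close> after a unit inserted on either side.\<close>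

lemma \<delta>_m_\<eta>: "X \<in> Obj B \<Longrightarrow> \<delta> X \<cdot> m X \<cdot> F\<star> (\<eta> X) = \<delta> X"
  using \<delta>_theta by (simp add: theta_def)

section \<open>The coaction induced by a module\<close>

lemma coaction_hom:
  "X \<in> Obj B \<Longrightarrow> \<rho> \<in> hom B (F\<bullet> X) X \<Longrightarrow> coaction B F \<delta> \<eta> X \<rho> \<in> hom B X (F\<bullet> X)"
  by (simp add: coaction_def hom_def)

lemma coaction_comp_action:
  assumes "is_module B F m X \<rho>"
  shows "coaction B F \<delta> \<eta> X \<rho> \<cdot> \<rho> = F\<star> \<rho> \<cdot> \<delta> X"
proof -
  from assms have X [simp]: "X \<in> Obj B" and \<rho>: "\<rho> \<in> hom B (F\<bullet> X) X"
    and act: "\<rho> \<cdot> F\<star> \<rho> = \<rho> \<cdot> m X"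
    by (auto simp: is_module_def)
  note [simp] = homD[OF \<rho>]
  have "coaction B F \<delta> \<eta> X \<rho> \<cdot> \<rho> = F\<star> \<rho> \<cdot> \<delta> X \<cdot> \<eta> X \<cdot> \<rho>"
    by (simp add: coaction_def)
  \<comment> \<open>Naturality carries the trailing \<open>\<rho>\<close> leftwards past
    \<open>\<eta>\<close> and then \<open>\<delta>\<close>, until it meets the other
    \<open>\<rho>\<close> under \<open>F\<close>.\<close>
  also have "\<dots> = F\<star> \<rho> \<cdot> \<delta> X \<cdot> F\<star> \<rho> \<cdot> \<eta> (F\<bullet> X)"
    by (simp add: \<eta>_natural[OF \<rho>])
  also have "\<dots> = F\<star> \<rho> \<cdot> F\<star> (F\<star> \<rho>) \<cdot> \<delta> (F\<bullet> X) \<cdot> \<eta> (F\<bullet> X)"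
    by (simp add: comp_left[OF \<delta>_natural[OF \<rho>]])
  \<comment> \<open>Regrouping under \<open>F\<close> exposes the left side of the module law. The
    law is then applied by \<open>unfolding\<close> before \<open>simp\<close>, because
    \<open>F_comp\<close> would split the composite again.\<close>
  also have "\<dots> = F\<star> (\<rho> \<cdot> F\<star> \<rho>) \<cdot> \<delta> (F\<bullet> X) \<cdot> \<eta> (F\<bullet> X)"
    by simp
  also have "\<dots> = F\<star> \<rho> \<cdot> F\<star> (m X) \<cdot> \<delta> (F\<bullet> X) \<cdot> \<eta> (F\<bullet> X)"
    unfolding act by simp
  also have "\<dots> = F\<star> \<rho> \<cdot> \<delta> X \<cdot> m X \<cdot> \<eta> (F\<bullet> X)"
    by (simp add: comp_left[OF frobenius_left])
  also have "\<dots> = F\<star> \<rho> \<cdot> \<delta> X"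
    by (simp add: m_\<eta> \<delta>_m_\<eta>)
  finally show ?thesis .
qed

text \<open>Here naturality of \<open>m\<close> pulls \<open>\<rho>\<close> to the front, and the
  other half of the Frobenius property turns \<open>m \<cdot> F \<delta>\<close> into
  \<open>\<delta> \<cdot> m\<close>. The unit already has the form \<open>F \<eta>\<close>, ready to
  be absorbed.\<close>

lemma m_comp_F_coaction:
  assumes X [simp]: "X \<in> Obj B" and \<rho>: "\<rho> \<in> hom B (F\<bullet> X) X"
  shows "m X \<cdot> F\<star> (coaction B F \<delta> \<eta> X \<rho>) = F\<star> \<rho> \<cdot> \<delta> X"
proof -
  note [simp] = homD[OF \<rho>]
  have "m X \<cdot> F\<star> (coaction B F \<delta> \<eta> X \<rho>) = m X \<cdot> F\<star> (F\<star> \<rho>) \<cdot> F\<star> (\<delta> X) \<cdot> F\<star> (\<eta> X)"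
    by (simp add: coaction_def)
  also have "\<dots> = F\<star> \<rho> \<cdot> m (F\<bullet> X) \<cdot> F\<star> (\<delta> X) \<cdot> F\<star> (\<eta> X)"
    by (simp add: comp_left[OF m_natural[OF \<rho>]])
  also have "\<dots> = F\<star> \<rho> \<cdot> \<delta> X \<cdot> m X \<cdot> F\<star> (\<eta> X)"
    by (simp add: comp_left[OF frobenius_right])
  also have "\<dots> = F\<star> \<rho> \<cdot> \<delta> X"
    by (simp add: \<delta>_m_\<eta>)
  finally show ?thesis .
qed

lemma is_comodule_coaction:
  assumes "is_module B F m X \<rho>"
  shows "is_comodule B F \<delta> X (coaction B F \<delta> \<eta> X \<rho>)" (is "is_comodule B F \<delta> X ?\<omega>")
proof -
  from assms have X [simp]: "X \<in> Obj B" and \<rho>: "\<rho> \<in> hom B (F\<bullet> X) X"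
    by (auto simp: is_module_def)
  note [simp] = homD[OF \<rho>] homD[OF coaction_hom[OF X \<rho>]]
  \<comment> \<open>Expanding only the right-hand \<open>?\<omega>\<close> produces
    \<open>?\<omega> \<cdot> \<rho>\<close> under \<open>F\<close>, where
    \<open>coaction_comp_action\<close> applies. This reduces the comodule law to coassociativity
    and naturality of \<open>\<delta>\<close>.\<close>
  have "F\<star> ?\<omega> \<cdot> ?\<omega> = F\<star> (?\<omega> \<cdot> \<rho>) \<cdot> \<delta> X \<cdot> \<eta> X"
    by (simp add: coaction_def)
  also have "\<dots> = F\<star> (F\<star> \<rho>) \<cdot> F\<star> (\<delta> X) \<cdot> \<delta> X \<cdot> \<eta> X"
    unfolding coaction_comp_action[OF assms] by simp
  also have "\<dots> = F\<star> (F\<star> \<rho>) \<cdot> \<delta> (F\<bullet> X) \<cdot> \<delta> X \<cdot> \<eta> X"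
    by (simp add: comp_left[OF coassoc])
  also have "\<dots> = \<delta> X \<cdot> F\<star> \<rho> \<cdot> \<delta> X \<cdot> \<eta> X"
    by (simp add: comp_left[OF \<delta>_natural[OF \<rho>]])
  also have "\<dots> = \<delta> X \<cdot> ?\<omega>"
    by (simp add: coaction_def)
  finally show ?thesis
    using coaction_hom[OF X \<rho>] by (simp add: is_comodule_def)
qed

lemma frobenius_bimodule_coaction:
  assumes "is_module B F m X \<rho>"
  shows "frobenius_bimodule B F m \<delta> X \<rho> (coaction B F \<delta> \<eta> X \<rho>)"
  using assms is_comodule_coaction[OF assms] coaction_comp_action[OF assms] m_comp_F_coaction
  by (simp add: frobenius_bimodule_def is_module_def)

text \<open>Both \<open>\<omega> \<cdot> \<rho>\<close> and \<open>m \<cdot> F \<omega>\<close>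
  equal \<open>F \<rho> \<cdot> \<delta>\<close>, which gives the morphism law. Composing the first
  equality with \<open>\<eta>\<close> returns the definition of the coaction, which gives
  compatibility.\<close>

lemma compatible_morphism_coaction:
  assumes "is_module B F m X \<rho>"
  shows "compatible_morphism B F \<eta> (X, \<rho>) (F\<bullet> X, m X) (coaction B F \<delta> \<eta> X \<rho>)"
proof -
  from assms have X [simp]: "X \<in> Obj B" and \<rho>: "\<rho> \<in> hom B (F\<bullet> X) X"
    by (auto simp: is_module_def)
  note [simp] = homD[OF \<rho>] homD[OF coaction_hom[OF X \<rho>]]
  have "coaction B F \<delta> \<eta> X \<rho> \<cdot> \<rho> \<cdot> \<eta> X = coaction B F \<delta> \<eta> X \<rho>"
    by (subst comp_left[OF coaction_comp_action[OF assms]]) (simp_all add: coaction_def)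
  then show ?thesis
    using coaction_hom[OF X \<rho>] coaction_comp_action[OF assms] m_comp_F_coaction[OF X \<rho>]
    by (simp add: compatible_morphism_def module_morphism_def)
qed

text \<open>Used twice: for uniqueness of the bimodule structure on a module, and to recover the
  forgotten third component in \<open>Phi_forget\<close>.\<close>

lemma coaction_unique:
  assumes "frobenius_bimodule B F m \<delta> X \<rho> \<omega>"
    and "compatible_morphism B F \<eta> (X, \<rho>) (F\<bullet> X, m X) \<omega>"
  shows "\<omega> = coaction B F \<delta> \<eta> X \<rho>"
proof -
  from assms have X [simp]: "X \<in> Obj B" and \<rho>: "\<rho> \<in> hom B (F\<bullet> X) X" and \<omega>: "\<omega> \<in> hom B X (F\<bullet> X)"
    and bimodule: "\<omega> \<cdot> \<rho> = F\<star> \<rho> \<cdot> \<delta> X" and compatible: "\<omega> \<cdot> \<rho> \<cdot> \<eta> X = \<omega>"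
    by (auto simp: frobenius_bimodule_def is_module_def is_comodule_def compatible_morphism_def)
  note [simp] = homD[OF \<rho>] homD[OF \<omega>]
  have "\<omega> \<cdot> \<rho> \<cdot> \<eta> X = coaction B F \<delta> \<eta> X \<rho>"
    by (subst comp_left[OF bimodule]) (simp_all add: coaction_def)
  with compatible show ?thesis by simp
qed

text \<open>The coaction is built from natural maps and the image of the action under
  \<open>F\<close>: \<open>h\<close> passes \<open>\<eta>\<close> and \<open>\<delta>\<close> by
  naturality and the action by the module morphism law.\<close>

lemma frobenius_morphism_coaction:
  assumes "is_module B F m X \<rho>" "is_module B F m Y \<sigma>" and "module_morphism B F (X, \<rho>) (Y, \<sigma>) h"
  shows "frobenius_morphism B F
    (X, \<rho>, coaction B F \<delta> \<eta> X \<rho>) (Y, \<sigma>, coaction B F \<delta> \<eta> Y \<sigma>) h"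
proof -
  from assms have X [simp]: "X \<in> Obj B" and \<rho>: "\<rho> \<in> hom B (F\<bullet> X) X"
    and Y [simp]: "Y \<in> Obj B" and \<sigma>: "\<sigma> \<in> hom B (F\<bullet> Y) Y"
    and h: "h \<in> hom B X Y" and mor: "h \<cdot> \<rho> = \<sigma> \<cdot> F\<star> h"
    by (auto simp: is_module_def module_morphism_def)
  note [simp] = homD[OF \<rho>] homD[OF \<sigma>] homD[OF h]
  have "coaction B F \<delta> \<eta> Y \<sigma> \<cdot> h = F\<star> \<sigma> \<cdot> \<delta> Y \<cdot> \<eta> Y \<cdot> h"
    by (simp add: coaction_def)
  also have "\<dots> = F\<star> \<sigma> \<cdot> \<delta> Y \<cdot> F\<star> h \<cdot> \<eta> X"
    by (simp add: \<eta>_natural[OF h])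
  also have "\<dots> = F\<star> \<sigma> \<cdot> F\<star> (F\<star> h) \<cdot> \<delta> X \<cdot> \<eta> X"
    by (simp add: comp_left[OF \<delta>_natural[OF h]])
  also have "\<dots> = F\<star> (\<sigma> \<cdot> F\<star> h) \<cdot> \<delta> X \<cdot> \<eta> X"
    by simp
  \<comment> \<open>The morphism law is read from right to left under \<open>F\<close>, which brings
    \<open>F h\<close> to the front.\<close>
  also have "\<dots> = F\<star> h \<cdot> coaction B F \<delta> \<eta> X \<rho>"
    unfolding mor[symmetric] by (simp add: coaction_def)
  finally show ?thesis
    using h assms(3) by (simp add: frobenius_morphism_def comodule_morphism_def)
qed

section \<open>The categories of modules and of Frobenius bimodules\<close>

lemma module_morphism_ident:
  "is_module B F m X \<rho> \<Longrightarrow> module_morphism B F (X, \<rho>) (X, \<rho>) (Ident B X)"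
  by (auto simp: module_morphism_def is_module_def hom_def)

lemma comodule_morphism_ident:
  "is_comodule B F \<delta> X \<omega> \<Longrightarrow> comodule_morphism B F (X, \<omega>) (X, \<omega>) (Ident B X)"
  by (auto simp: comodule_morphism_def is_comodule_def hom_def)

lemma module_morphism_comp:
  assumes "\<rho> \<in> hom B (F\<bullet> X) X" "\<sigma> \<in> hom B (F\<bullet> Y) Y" "\<tau> \<in> hom B (F\<bullet> Z) Z"
    and "module_morphism B F (X, \<rho>) (Y, \<sigma>) h" "module_morphism B F (Y, \<sigma>) (Z, \<tau>) k"
  shows "module_morphism B F (X, \<rho>) (Z, \<tau>) (k \<cdot> h)"
proof -
  from assms have h: "h \<in> hom B X Y" "h \<cdot> \<rho> = \<sigma> \<cdot> F\<star> h"
    and k: "k \<in> hom B Y Z" "k \<cdot> \<sigma> = \<tau> \<cdot> F\<star> k"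
    by (auto simp: module_morphism_def)
  note [simp] = homD[OF assms(1)] homD[OF assms(2)] homD[OF assms(3)] homD[OF h(1)] homD[OF k(1)]
  have "(k \<cdot> h) \<cdot> \<rho> = \<tau> \<cdot> F\<star> (k \<cdot> h)"
    by (simp add: h(2) comp_left[OF k(2)])
  then show ?thesis
    using hom_comp[OF h(1) k(1)] by (simp add: module_morphism_def)
qed

lemma comodule_morphism_comp:
  assumes "\<rho> \<in> hom B X (F\<bullet> X)" "\<sigma> \<in> hom B Y (F\<bullet> Y)" "\<tau> \<in> hom B Z (F\<bullet> Z)"
    and "comodule_morphism B F (X, \<rho>) (Y, \<sigma>) h" "comodule_morphism B F (Y, \<sigma>) (Z, \<tau>) k"
  shows "comodule_morphism B F (X, \<rho>) (Z, \<tau>) (k \<cdot> h)"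
proof -
  from assms have h: "h \<in> hom B X Y" "\<sigma> \<cdot> h = F\<star> h \<cdot> \<rho>"
    and k: "k \<in> hom B Y Z" "\<tau> \<cdot> k = F\<star> k \<cdot> \<sigma>"
    by (auto simp: comodule_morphism_def)
  note [simp] = homD[OF assms(1)] homD[OF assms(2)] homD[OF assms(3)] homD[OF h(1)] homD[OF k(1)]
  have "\<tau> \<cdot> k \<cdot> h = F\<star> (k \<cdot> h) \<cdot> \<rho>"
    by (simp add: h(2) comp_left[OF k(2)])
  then show ?thesis
    using hom_comp[OF h(1) k(1)] by (simp add: comodule_morphism_def)
qed

lemma category_compatible_modules: "category (compatible_modules B F m \<eta>)"
  unfolding compatible_modules_def
proof (rule category_structured_cat, goal_cases)
  case (3 x)
  then show ?case
    by (auto simp: compatible_module_def intro: module_morphism_ident)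
next
  case (4 x y z h k)
  then show ?case
    \<comment> \<open>The intermediate object does not occur in the conclusion. Rotating the typing
      premises to the end makes a morphism the major premise, whose match fixes that object.\<close>
    by (auto simp: compatible_module_def is_module_def elim!: module_morphism_comp[rotated 3])
qed (auto simp: compatible_module_def is_module_def module_morphism_def)

lemma category_frobenius_bimodules: "category (frobenius_bimodules B F m \<delta> \<eta>)"
  unfolding frobenius_bimodules_def
proof (rule category_structured_cat, goal_cases)
  case (3 x)
  then show ?case
    by (auto simp: frobenius_bimodule_def frobenius_morphism_def
        intro: module_morphism_ident comodule_morphism_ident)
next
  case (4 x y z h k)
  then show ?case
    by (auto simp: frobenius_bimodule_def frobenius_morphism_def is_module_def is_comodule_def
        elim!: module_morphism_comp[rotated 3] comodule_morphism_comp[rotated 3])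
qed (auto simp: compatible_module_def is_module_def frobenius_morphism_def module_morphism_def)

section \<open>The functors \<open>Phi\<close> and \<open>forget\<close> and their
  composites\<close>

lemma is_functor_Phi:
  "is_functor (compatible_modules B F m \<eta>) (frobenius_bimodules B F m \<delta> \<eta>) (Phi B F \<delta> \<eta>)"
  using category_compatible_modules category_frobenius_bimodules
    frobenius_bimodule_coaction frobenius_morphism_coaction
  unfolding is_functor_def
  by (auto simp: compatible_modules_def frobenius_bimodules_def structured_cat_def Phi_def
      hom_def compatible_module_def)

lemma is_functor_forget:
  "is_functor (frobenius_bimodules B F m \<delta> \<eta>) (compatible_modules B F m \<eta>) forget"
  using category_compatible_modules category_frobenius_bimodules
  unfolding is_functor_def
  by (auto simp: compatible_modules_def frobenius_bimodules_def structured_cat_def forget_def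
      hom_def frobenius_morphism_def)

text \<open>Adding a component and dropping it again is the identity on all pairs and triples, hence
  over any \<open>C\<close>.\<close>

lemma forget_Phi: "ftor_eq C (forget \<odot> Phi B F \<delta> \<eta>) id_ftor"
  by (auto simp: ftor_eq_def comp_ftor_def id_ftor_def forget_def Phi_def)

text \<open>Membership in the full subcategory supplies the compatibility of
  \<open>\<omega>\<close>, so \<open>coaction_unique\<close> identifies it with the coaction that
  \<open>Phi\<close> rebuilds.\<close>

lemma Phi_forget:
  "ftor_eq (compatible_frobenius_bimodules B F m \<delta> \<eta>) (Phi B F \<delta> \<eta> \<odot> forget) id_ftor"
  by (auto simp: ftor_eq_def comp_ftor_def id_ftor_def forget_def Phi_def full_subcat_def
      compatible_frobenius_bimodules_def frobenius_bimodules_def structured_cat_def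
      intro: coaction_unique[symmetric])

lemma iso_of_categories_Phi_forget:
  "iso_of_categories (compatible_modules B F m \<eta>) (compatible_frobenius_bimodules B F m \<delta> \<eta>)
     (Phi B F \<delta> \<eta>) forget"
proof -
  \<comment> \<open>By fullness, corestricting \<open>Phi\<close> requires a check on objects only,
    and that check is the compatibility of the coaction.\<close>
  have "(Phi B F \<delta> \<eta>)\<bullet> x \<in> {(X, \<rho>, \<omega>). compatible_morphism B F \<eta> (X, \<rho>) (F\<bullet> X, m X) \<omega>}"
    if "x \<in> Obj (compatible_modules B F m \<eta>)" for x
    using that
    by (auto simp: compatible_modules_def structured_cat_def Phi_def compatible_module_def
        intro: compatible_morphism_coaction)
  from is_functor_full_subcat_codomain[OF is_functor_Phi this]
    is_functor_full_subcat_domain[OF is_functor_forget] forget_Phi Phi_forget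
  show ?thesis
    unfolding iso_of_categories_def compatible_frobenius_bimodules_def by simp
qed

end

theorem theorem4p3:
  fixes B :: "('o, 'a) cat" and F :: "('o, 'a) endo" and m \<delta> \<eta> :: "'o \<Rightarrow> 'a"
  assumes "category B"
    and "is_functor B B F"
    and "nonunital_monad B F m"
    and "noncounital_comonad B F \<delta>"
    and "frobenius_property B F m \<delta>"
    and "weak_monad B F m \<eta>"
    and "\<forall>X\<in>Obj B. \<delta> X = \<delta> X \<cdot>\<^bsub>B\<^esub> theta B F m \<eta> X"
  shows
    "(\<forall>X \<rho>. compatible_module B F m \<eta> X \<rho> \<longrightarrow>
        (\<exists>!\<omega>. compatible_morphism B F \<eta> (X, \<rho>) (F\<bullet> X, m X) \<omega> \<and>
              frobenius_bimodule B F m \<delta> X \<rho> \<omega>) \<and>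
        compatible_morphism B F \<eta> (X, \<rho>) (F\<bullet> X, m X) (coaction B F \<delta> \<eta> X \<rho>) \<and>
        frobenius_bimodule B F m \<delta> X \<rho> (coaction B F \<delta> \<eta> X \<rho>)) \<and>
     (\<forall>X \<rho> Y \<sigma> h. compatible_module B F m \<eta> X \<rho> \<and> compatible_module B F m \<eta> Y \<sigma> \<and>
        module_morphism B F (X, \<rho>) (Y, \<sigma>) h \<longrightarrow>
        frobenius_morphism B F (X, \<rho>, coaction B F \<delta> \<eta> X \<rho>) (Y, \<sigma>, coaction B F \<delta> \<eta> Y \<sigma>) h) \<and>
     is_functor (compatible_modules B F m \<eta>) (frobenius_bimodules B F m \<delta> \<eta>) (Phi B F \<delta> \<eta>) \<and>
     is_functor (frobenius_bimodules B F m \<delta> \<eta>) (compatible_modules B F m \<eta>) forget \<and>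
     ftor_eq (compatible_modules B F m \<eta>) (forget \<odot> Phi B F \<delta> \<eta>) id_ftor \<and>
     iso_of_categories (compatible_modules B F m \<eta>) (compatible_frobenius_bimodules B F m \<delta> \<eta>)
       (Phi B F \<delta> \<eta>) forget"
proof -
  interpret weak_frobenius_monad B F m \<delta> \<eta>
    using assms by unfold_locales
  note coaction_props = frobenius_bimodule_coaction compatible_morphism_coaction
  have "\<exists>!\<omega>. compatible_morphism B F \<eta> (X, \<rho>) (F\<bullet> X, m X) \<omega> \<and> frobenius_bimodule B F m \<delta> X \<rho> \<omega>"
    if "is_module B F m X \<rho>" for X \<rho>
    \<comment> \<open>The witness is forced: \<open>coaction_unique\<close> equates every candidate
      with the coaction.\<close>
    by (rule ex1I[of _ "coaction B F \<delta> \<eta> X \<rho>"])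
      (use that in \<open>blast intro: coaction_props\<close>, blast intro: coaction_unique)
  then show ?thesis
    unfolding compatible_module_def
    by (intro conjI allI impI is_functor_Phi is_functor_forget forget_Phi
        iso_of_categories_Phi_forget coaction_props frobenius_morphism_coaction) simp_all
qed

end
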